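(* Any quintic (degree $5$) quasi-homogeneous but non-homogeneous polynomial differential system, when restricted to either $y>0$ or $x>0$, can be transformed (by the change of variables $\tilde x=x^{s_2}$, $\tilde y=y^{s_1}$ and a time rescaling, and writing $x,y$ again for $\tilde x,\tilde y$) to one of the following four homogeneous systems, with real coefficients: - $\mathcal H_3$: $\dot x=x(c_{12}y^2+c_{21}xy+c_{30}x^2)$, $\dot y=y(d_{03}y^2+d_{12}xy+d_{21}x^2)$, with $c_{30}d_{03}\neq0$; - $\mathcal H_2$: $\dot x=c_{02}y^2+c_{11}xy+c_{20}x^2$, $\dot y=d_{02}y^2+d_{11}xy+d_{20}x^2$, with either $c_{02}d_{20}\ne0$, or $c_{02}=d_{20}=0$ and $c_{20}d_{02}\neq0$; - $\mathcal H_1$: $\dot x=c_{01}y+c_{10}x$, $\dot y=d_{01}y+d_{10}x$, with either $c_{01}d_{10}\ne0$, or $d_{10}=0$ and $c_{01}c_{10}d_{01}\ne0$, or $c_{01}=0$ and $c_{10}d_{01}d_{10}\neq0$; - $\mathcal H_0$: $\dot x=c_0$, $\dot y=d_0$, with $c_0d_0\neq0$.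
   Context: Consider real planar polynomial systems $\dot x=P(x,y)$, $\dot y=Q(x,y)$ with $P,Q\in\mathbb R[x,y]$, $PQ\not\equiv0$, the origin being a singularity, and $P,Q$ having no non-constant common factor. The degree of the system is $\max\{\deg P,\deg Q\}$. The system is quasi-homogeneous if there exist positive integers $s_1,s_2,d$ such that for all $\alpha>0$ $$P(\alpha^{s_1}x,\alpha^{s_2}y)=\alpha^{s_1+d-1}P(x,y),\qquad Q(\alpha^{s_1}x,\alpha^{s_2}y)=\alpha^{s_2+d-1}Q(x,y).$$ Then $(s_1,s_2,d)$ is called a weight vector of the system. A weight vector $(\tilde s_1,\tilde s_2,\tilde d)$ is minimal if every other weight vector $(s_1,s_2,d)$ of the system satisfies $\tilde s_1\le s_1$, $\tilde s_2\le s_2$, $\tilde d\le d$; each quasi-homogeneous but non-homogeneous system has a unique minimal weight vector, and $(s_1,s_2,d)$ denotes it in the claim. The system is homogeneous of degree $d$ if $P(\alpha x,\alpha y)=\alpha^{d}P(x,y)$ and $Q(\alpha x,\alpha y)=\alpha^{d}Q(x,y)$ for all $\alpha>0$ (that is, $(s_1,s_2,d)$ with $s_1=s_2=1$ is a weight vector). It is assumed (exchanging $x$ and $y$ if necessary) that $s_1>s_2$. At most one of $s_1,s_2$ is even; the restriction is to $y>0$ when $s_1$ is even and to $x>0$ when $s_2$ is even (either may be used when both are odd), so that the change $\tilde x=x^{s_2},\tilde y=y^{s_1}$ is one-to-one there. A time rescaling means a change of time $dt=dt_1/(\tilde x^{a}\tilde y^{b})$ with rational exponents $a,b\ge 0$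 (possibly $a=b=0$), performed where the factor $\tilde x^{a}\tilde y^{b}$ is nonzero. *)

theory Defs
  imports "HOL-Analysis.Analysis" "HOL-Computational_Algebra.Computational_Algebra"
begin

text \<open>
  An element \<open>p :: real poly poly\<close> is read as a polynomial in \<open>y\<close> with coefficients in
  \<open>\<real>[x]\<close>: the coefficient of \<open>x^i y^j\<close> is \<open>coeff (coeff p j) i\<close>.
\<close>

definition eval2 :: "real poly poly \<Rightarrow> real \<Rightarrow> real \<Rightarrow> real" where
  "eval2 p x y = poly (poly p [:y:]) x"

definition total_degree :: "real poly poly \<Rightarrow> nat" where
  "total_degree p = Max (insert 0 {i + j | i j. coeff (coeff p j) i \<noteq> 0})"

definition planar_field :: "real poly poly \<Rightarrow> real poly poly \<Rightarrow> real \<times> real \<Rightarrow> real \<times> real" where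
  "planar_field P Q = (\<lambda>(x, y). (eval2 P x y, eval2 Q x y))"

definition system_degree :: "real poly poly \<Rightarrow> real poly poly \<Rightarrow> nat" where
  "system_degree P Q = max (total_degree P) (total_degree Q)"

text \<open>
  As \<open>\<real>[x][y]\<close> has the nonzero constants as its units, \<open>coprime P Q\<close> says that \<open>P\<close> and \<open>Q\<close>
  have no non-constant common factor.
\<close>

definition admissible_system :: "real poly poly \<Rightarrow> real poly poly \<Rightarrow> bool" where
  "admissible_system P Q \<longleftrightarrow>
     P * Q \<noteq> 0 \<and> eval2 P 0 0 = 0 \<and> eval2 Q 0 0 = 0 \<and> coprime P Q"

definition weight_vector ::
  "real poly poly \<Rightarrow> real poly poly \<Rightarrow> nat \<Rightarrow> nat \<Rightarrow> nat \<Rightarrow> bool" where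
  "weight_vector P Q s1 s2 d \<longleftrightarrow>
     0 < s1 \<and> 0 < s2 \<and> 0 < d \<and>
     (\<forall>\<alpha>>0. \<forall>x y.
        eval2 P (\<alpha> ^ s1 * x) (\<alpha> ^ s2 * y) = \<alpha> ^ (s1 + d - 1) * eval2 P x y \<and>
        eval2 Q (\<alpha> ^ s1 * x) (\<alpha> ^ s2 * y) = \<alpha> ^ (s2 + d - 1) * eval2 Q x y)"

definition quasi_homogeneous :: "real poly poly \<Rightarrow> real poly poly \<Rightarrow> bool" where
  "quasi_homogeneous P Q \<longleftrightarrow> (\<exists>s1 s2 d. weight_vector P Q s1 s2 d)"

definition minimal_weight_vector ::
  "real poly poly \<Rightarrow> real poly poly \<Rightarrow> nat \<Rightarrow> nat \<Rightarrow> nat \<Rightarrow> bool" where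
  "minimal_weight_vector P Q s1 s2 d \<longleftrightarrow>
     weight_vector P Q s1 s2 d \<and>
     (\<forall>t1 t2 e. weight_vector P Q t1 t2 e \<longrightarrow> s1 \<le> t1 \<and> s2 \<le> t2 \<and> d \<le> e)"

definition homogeneous :: "real poly poly \<Rightarrow> real poly poly \<Rightarrow> bool" where
  "homogeneous P Q \<longleftrightarrow>
     (\<exists>d. \<forall>\<alpha>>0. \<forall>x y.
        eval2 P (\<alpha> * x) (\<alpha> * y) = \<alpha> ^ d * eval2 P x y \<and>
        eval2 Q (\<alpha> * x) (\<alpha> * y) = \<alpha> ^ d * eval2 Q x y)"

definition restriction_domain :: "nat \<Rightarrow> nat \<Rightarrow> (real \<times> real) set \<Rightarrow> bool" where
  "restriction_domain s1 s2 U \<longleftrightarrow>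
     (U = {(x, y). y > 0} \<or> U = {(x, y). x > 0}) \<and>
     (even s1 \<longrightarrow> U = {(x, y). y > 0}) \<and>
     (even s2 \<longrightarrow> U = {(x, y). x > 0})"

text \<open>
  For a rational exponent \<open>p/q\<close> in lowest terms with \<open>q > 0\<close>, the power of \<open>x\<close> is
  \<open>(root q x)^p\<close>.  For \<open>x < 0\<close> this is meaningful only if \<open>q\<close> is odd (HOL's \<open>root q\<close> is an odd
  function for every \<open>q\<close>, so even \<open>q\<close> must be excluded there explicitly).
\<close>

definition rat_power :: "real \<Rightarrow> rat \<Rightarrow> real" where
  "rat_power x r = (case quotient_of r of (p, q) \<Rightarrow> root (nat q) x powi p)"

definition rat_power_defined :: "real \<Rightarrow> rat \<Rightarrow> bool" where
  "rat_power_defined x r \<longleftrightarrow> 0 \<le> x \<or> odd (snd (quotient_of r))"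

text \<open>
  If \<open>\<gamma>' = F \<circ> \<gamma>\<close>, then \<open>(\<Phi> \<circ> \<gamma>)' = D (F \<circ> \<gamma>)\<close> with \<open>D\<close> the derivative of \<open>\<Phi>\<close> along \<open>\<gamma>\<close>.  In the
  new time \<open>t\<^sub>1\<close> with \<open>dt = dt\<^sub>1 / \<rho>\<close>, where \<open>\<rho>\<close> is a function of the new variables, this velocity
  is divided by \<open>\<rho>\<close>; so the transformed system is \<open>G\<close> iff \<open>D (F p) = \<rho> (\<Phi> p) G (\<Phi> p)\<close>.
\<close>

definition transforms_on ::
  "(real \<times> real) set \<Rightarrow> (real \<times> real \<Rightarrow> real \<times> real) \<Rightarrow> (real \<times> real \<Rightarrow> real) \<Rightarrow>
   (real \<times> real \<Rightarrow> real \<times> real) \<Rightarrow> (real \<times> real \<Rightarrow> real \<times> real) \<Rightarrow> bool" where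
  "transforms_on V \<Phi> \<rho> F G \<longleftrightarrow>
     (\<forall>p\<in>V. \<rho> (\<Phi> p) \<noteq> 0 \<and>
        (\<exists>D. (\<Phi> has_derivative D) (at p) \<and> D (F p) = \<rho> (\<Phi> p) *\<^sub>R G (\<Phi> p)))"

definition power_change :: "nat \<Rightarrow> nat \<Rightarrow> real \<times> real \<Rightarrow> real \<times> real" where
  "power_change s1 s2 = (\<lambda>(x, y). (x ^ s2, y ^ s1))"

definition time_factor :: "rat \<Rightarrow> rat \<Rightarrow> real \<times> real \<Rightarrow> real" where
  "time_factor a b = (\<lambda>(u, v). rat_power u a * rat_power v b)"

definition transformable ::
  "nat \<Rightarrow> nat \<Rightarrow> (real \<times> real) set \<Rightarrow>
   (real \<times> real \<Rightarrow> real \<times> real) \<Rightarrow> (real \<times> real \<Rightarrow> real \<times> real) \<Rightarrow> bool" where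
  "transformable s1 s2 U F G \<longleftrightarrow>
     inj_on (power_change s1 s2) U \<and>
     (\<exists>a b. 0 \<le> a \<and> 0 \<le> b \<and>
        (\<forall>(u, v) \<in> power_change s1 s2 ` U. rat_power_defined u a \<and> rat_power_defined v b) \<and>
        transforms_on {p \<in> U. time_factor a b (power_change s1 s2 p) \<noteq> 0}
          (power_change s1 s2) (time_factor a b) F G)"

definition is_H3 :: "(real \<times> real \<Rightarrow> real \<times> real) \<Rightarrow> bool" where
  "is_H3 G \<longleftrightarrow>
     (\<exists>c12 c21 c30 d03 d12 d21.
        G = (\<lambda>(x, y). (x * (c12 * y\<^sup>2 + c21 * x * y + c30 * x\<^sup>2),
                       y * (d03 * y\<^sup>2 + d12 * x * y + d21 * x\<^sup>2))) \<and>
        c30 * d03 \<noteq> 0)"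

definition is_H2 :: "(real \<times> real \<Rightarrow> real \<times> real) \<Rightarrow> bool" where
  "is_H2 G \<longleftrightarrow>
     (\<exists>c02 c11 c20 d02 d11 d20.
        G = (\<lambda>(x, y). (c02 * y\<^sup>2 + c11 * x * y + c20 * x\<^sup>2,
                       d02 * y\<^sup>2 + d11 * x * y + d20 * x\<^sup>2)) \<and>
        (c02 * d20 \<noteq> 0 \<or> c02 = 0 \<and> d20 = 0 \<and> c20 * d02 \<noteq> 0))"

definition is_H1 :: "(real \<times> real \<Rightarrow> real \<times> real) \<Rightarrow> bool" where
  "is_H1 G \<longleftrightarrow>
     (\<exists>c01 c10 d01 d10.
        G = (\<lambda>(x, y). (c01 * y + c10 * x, d01 * y + d10 * x)) \<and>
        (c01 * d10 \<noteq> 0 \<or> d10 = 0 \<and> c01 * c10 * d01 \<noteq> 0 \<or> c01 = 0 \<and> c10 * d01 * d10 \<noteq> 0))"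

definition is_H0 :: "(real \<times> real \<Rightarrow> real \<times> real) \<Rightarrow> bool" where
  "is_H0 G \<longleftrightarrow> (\<exists>c0 d0. G = (\<lambda>(x, y). (c0, d0)) \<and> c0 * d0 \<noteq> 0)"

end

theory Submission
  imports Defs "HOL-Number_Theory.Cong"
begin

text \<open>
  Quasi-homogeneity with weights \<open>s1, s2\<close> puts the monomials of \<open>P\<close> and of \<open>Q\<close> on two parallel
  lines of exponents, and minimality of the weight vector makes \<open>s1\<close> and \<open>s2\<close> coprime.  In the
  variables \<open>u = x^s2\<close>, \<open>v = y^s1\<close> the velocity is \<open>(s2 * x^(s2-1) * P, s1 * y^(s1-1) * Q)\<close>, and the
  two extra factors move both lines of exponents onto the single line \<open>s1*e + s2*f = s1*s2 + d - 1\<close>.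
  Its lattice points are \<open>(r + s2*k, t + s1*(N - k))\<close> with residues \<open>r < s2\<close>, \<open>t < s1\<close> and
  \<open>0 \<le> k \<le> N\<close> (lemma \<open>common_weight_line\<close>).  So both components are \<open>x^r * y^t\<close> times a homogeneous
  form of degree \<open>N\<close> in \<open>u\<close> and \<open>v\<close>, and \<open>x^r * y^t = u^(r/s2) * v^(t/s1)\<close> is the time factor to be
  divided out (lemma \<open>transformable_by_power_change\<close>).

  The rest is a count of exponents (lemma \<open>quintic_form_field_cases\<close>).  Let \<open>a k\<close>, \<open>b k\<close> be the
  coefficients of \<open>u^k * v^(N-k)\<close> in the two forms.  As \<open>x\<close> is no common factor of \<open>P\<close> and \<open>Q\<close>,
  either \<open>Q\<close> has a pure power of \<open>y\<close>, whence \<open>r = 0\<close> and \<open>b 0 \<noteq> 0\<close>, or \<open>P\<close> has one, whence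
  \<open>r = s2 - 1\<close> and \<open>a 0 \<noteq> 0\<close>; likewise, as \<open>y\<close> is no common factor, \<open>t = 0\<close> and \<open>a N \<noteq> 0\<close>, or
  \<open>t = s1 - 1\<close> and \<open>b N \<noteq> 0\<close>.  The monomials given by \<open>a 0\<close> and \<open>b 0\<close> have \<open>y\<close>-exponents
  \<open>t + s1*N\<close> and \<open>t + s1*(N-1) + 1\<close>; with \<open>s1 \<ge> 2\<close> and total degree at most 5 this forces \<open>N \<le> 3\<close>.
  For each of the four degrees, the nonvanishing conditions on the coefficients follow from the
  same alternatives; that the degree is exactly 5 excludes the linear field with \<open>P = x\<close> and
  \<open>Q = y\<close> up to constants, and for \<open>N = 2\<close> the fields with \<open>s1 = 2\<close>, \<open>s2 = 1\<close> whose degree is 4.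
\<close>

section \<open>Coefficients and evaluation of bivariate polynomials\<close>

abbreviation coeff2 :: "real poly poly \<Rightarrow> nat \<Rightarrow> nat \<Rightarrow> real" where
  "coeff2 p i j \<equiv> coeff (coeff p j) i"

lemma finite_support: "finite {(i, j). coeff2 p i j \<noteq> 0}"
proof (rule finite_subset)
  show "{(i, j). coeff2 p i j \<noteq> 0} \<subseteq> (\<Union>j\<le>degree p. {..degree (coeff p j)} \<times> {j})"
    by (auto simp: le_degree) (metis coeff_0 le_degree)
qed auto

lemma eval2_eq_sum:
  assumes S: "finite S" "\<And>i j. coeff2 p i j \<noteq> 0 \<Longrightarrow> (i, j) \<in> S"
  shows "eval2 p x y = (\<Sum>(i, j)\<in>S. coeff2 p i j * x ^ i * y ^ j)"
proof -
  let ?f = "\<lambda>(i, j). coeff2 p i j * x ^ i * y ^ j"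
  let ?T = "{(i, j). coeff2 p i j \<noteq> 0}"
  let ?R = "SIGMA j:{..degree p}. {..degree (coeff p j)}"
  have "eval2 p x y = (\<Sum>j\<le>degree p. poly (coeff p j) x * y ^ j)"
    by (simp add: eval2_def poly_altdef [of p] poly_sum)
  also have "\<dots> = (\<Sum>j\<le>degree p. \<Sum>i\<le>degree (coeff p j). ?f (i, j))"
    by (simp add: poly_altdef sum_distrib_right)
  also have "\<dots> = (\<Sum>(j, i)\<in>?R. ?f (i, j))"
    by (rule sum.Sigma) auto
  also have "\<dots> = sum ?f (prod.swap ` ?R)"
    by (subst sum.reindex) (auto simp: split_def)
  also have "\<dots> = sum ?f ?T"
  proof (rule sum.mono_neutral_right)
    show "?T \<subseteq> prod.swap ` ?R"
      by (auto simp: image_iff le_degree) (metis coeff_0 le_degree)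
  qed auto
  also have "\<dots> = sum ?f S"
    by (rule sum.mono_neutral_left) (use S in auto)
  finally show ?thesis .
qed

text \<open>
  For fixed \<open>y\<close> agreement at all \<open>x\<close> identifies two polynomials in \<open>x\<close>; so \<open>p - q\<close>, as a polynomial
  in one variable over the integral domain \<open>\<real>[x]\<close>, has all constants as roots.
\<close>

lemma eval2_inject:
  assumes "\<And>x y. eval2 p x y = eval2 q x y"
  shows "p = q"
proof (rule ccontr)
  assume "p \<noteq> q"
  then have "finite {z. poly (p - q) z = 0}"
    by (intro poly_roots_finite) simp
  moreover have "range (\<lambda>y. [:y:]) \<subseteq> {z. poly (p - q) z = 0}"
  proof clarify
    fix y :: real
    have "poly p [:y:] = poly q [:y:]"
      using assms by (simp add: eval2_def poly_eq_poly_eq_iff [symmetric] fun_eq_iff)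
    then show "poly (p - q) [:y:] = 0" by simp
  qed
  ultimately have "finite (range (\<lambda>y :: real. [:y:]))"
    using finite_subset by blast
  then have "finite (UNIV :: real set)"
    by (rule finite_imageD) (auto simp: inj_on_def)
  then show False by (simp add: infinite_UNIV_char_0)
qed

section \<open>Weight vectors and supports\<close>

text \<open>
  The single scaling \<open>\<alpha> = 2\<close> already determines the support: it multiplies the coefficient of
  \<open>x^i y^j\<close> by \<open>2^(s1*i + s2*j)\<close>, and the powers of 2 are pairwise different.
\<close>

lemma weighted_homogeneous_iff_support:
  "(\<forall>\<alpha>>0. \<forall>x y. eval2 p (\<alpha> ^ s1 * x) (\<alpha> ^ s2 * y) = \<alpha> ^ m * eval2 p x y) \<longleftrightarrow>
   (\<forall>i j. coeff2 p i j \<noteq> 0 \<longrightarrow> s1 * i + s2 * j = m)"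
  (is "?hom \<longleftrightarrow> ?supp")
proof
  assume hom: ?hom
  \<comment> \<open>the polynomial of the rescaled function, to which uniqueness of coefficients applies\<close>
  define q where "q = map_poly (\<lambda>f. f \<circ>\<^sub>p [:0, 2 ^ s1:]) (p \<circ>\<^sub>p [:0, [:2 ^ s2:]:])"
  let ?S = "{(i, j). coeff2 p i j \<noteq> 0}"
  have coeff_q: "coeff2 q i j = 2 ^ (s1 * i + s2 * j) * coeff2 p i j" for i j
    by (simp add: q_def coeff_map_poly coeff_pcompose_linear poly_const_pow power_mult power_add)
  have "q = smult [:2 ^ m:] p"
  proof (rule eval2_inject)
    fix x y
    have "eval2 q x y = (\<Sum>(i, j)\<in>?S. coeff2 q i j * x ^ i * y ^ j)"
      by (rule eval2_eq_sum) (use finite_support in \<open>auto simp: coeff_q\<close>)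
    also have "\<dots> = (\<Sum>(i, j)\<in>?S. coeff2 p i j * (2 ^ s1 * x) ^ i * (2 ^ s2 * y) ^ j)"
      by (intro sum.cong) (auto simp: coeff_q power_add power_mult power_mult_distrib)
    also have "\<dots> = eval2 p (2 ^ s1 * x) (2 ^ s2 * y)"
      by (rule eval2_eq_sum [symmetric]) (use finite_support in auto)
    also have "\<dots> = 2 ^ m * eval2 p x y"
      using hom by simp
    also have "\<dots> = eval2 (smult [:2 ^ m:] p) x y"
      by (simp add: eval2_def)
    finally show "eval2 q x y = eval2 (smult [:2 ^ m:] p) x y" .
  qed
  then have "coeff2 q i j = 2 ^ m * coeff2 p i j" for i j
    by simp
  then have "(2::real) ^ (s1 * i + s2 * j) = 2 ^ m \<or> coeff2 p i j = 0" for i j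
    using coeff_q [of j i] by (metis mult_cancel_right)
  then show ?supp
    by auto
next
  assume supp: ?supp
  let ?S = "{(i, j). coeff2 p i j \<noteq> 0}"
  have "eval2 p (\<alpha> ^ s1 * x) (\<alpha> ^ s2 * y) = \<alpha> ^ m * eval2 p x y" for \<alpha> x y
  proof -
    have "eval2 p (\<alpha> ^ s1 * x) (\<alpha> ^ s2 * y) =
        (\<Sum>(i, j)\<in>?S. coeff2 p i j * (\<alpha> ^ s1 * x) ^ i * (\<alpha> ^ s2 * y) ^ j)"
      by (rule eval2_eq_sum) (use finite_support in auto)
    also have "\<dots> = (\<Sum>(i, j)\<in>?S. \<alpha> ^ m * (coeff2 p i j * x ^ i * y ^ j))"
    proof (intro sum.cong refl, clarify)
      fix i j assume "coeff2 p i j \<noteq> 0"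
      then have "m = s1 * i + s2 * j" using supp by simp
      then show "coeff2 p i j * (\<alpha> ^ s1 * x) ^ i * (\<alpha> ^ s2 * y) ^ j =
          \<alpha> ^ m * (coeff2 p i j * x ^ i * y ^ j)"
        by (simp add: power_add power_mult power_mult_distrib)
    qed
    also have "\<dots> = \<alpha> ^ m * eval2 p x y"
      by (subst eval2_eq_sum [of ?S p]) (use finite_support in \<open>auto simp: sum_distrib_left split_def\<close>)
    finally show ?thesis .
  qed
  then show ?hom by blast
qed

lemma weight_vector_iff_support:
  "weight_vector P Q s1 s2 d \<longleftrightarrow> 0 < s1 \<and> 0 < s2 \<and> 0 < d \<and>
     (\<forall>i j. coeff2 P i j \<noteq> 0 \<longrightarrow> s1 * i + s2 * j = s1 + d - 1) \<and>
     (\<forall>i j. coeff2 Q i j \<noteq> 0 \<longrightarrow> s1 * i + s2 * j = s2 + d - 1)"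
  unfolding weight_vector_def weighted_homogeneous_iff_support [symmetric] by blast

lemma nonzero_obtain_coeff2:
  assumes "p \<noteq> 0"
  obtains i j where "coeff2 p i j \<noteq> 0"
  using assms by (metis coeff_0 poly_eqI)

text \<open>
  A common divisor \<open>g\<close> of the weights divides \<open>d - 1\<close>, because some monomial of \<open>P\<close> satisfies
  \<open>s1*i + s2*j = s1 + d - 1\<close>.  Dividing the equations of the supports by \<open>g\<close> then gives a weight
  vector with first weight \<open>s1 / g\<close>, and minimality forces \<open>g = 1\<close>.
\<close>

lemma minimal_weights_coprime:
  assumes min: "minimal_weight_vector P Q s1 s2 d" and "P \<noteq> 0"
  shows "coprime s1 s2"
proof -
  define g where "g = gcd s1 s2"
  have wv: "weight_vector P Q s1 s2 d"
    using min by (simp add: minimal_weight_vector_def)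
  then have pos: "0 < s1" "0 < s2" "0 < d"
    and P: "\<And>i j. coeff2 P i j \<noteq> 0 \<Longrightarrow> s1 * i + s2 * j = s1 + d - 1"
    and Q: "\<And>i j. coeff2 Q i j \<noteq> 0 \<Longrightarrow> s1 * i + s2 * j = s2 + d - 1"
    by (auto simp: weight_vector_iff_support)
  have "0 < g" using pos by (simp add: g_def)
  obtain t1 t2 where t: "s1 = g * t1" "s2 = g * t2"
    unfolding g_def by (metis dvdE gcd_dvd1 gcd_dvd2)
  obtain i j where "coeff2 P i j \<noteq> 0"
    using \<open>P \<noteq> 0\<close> by (rule nonzero_obtain_coeff2)
  then have "g * (t1 * i + t2 * j) = g * t1 + (d - 1)"
    using P [of j i] pos by (simp add: t algebra_simps)
  then have "g dvd d - 1"
    by (metis dvd_add_right_iff dvd_triv_left)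
  then obtain e where e: "d - 1 = g * e" ..
  have "weight_vector P Q t1 t2 (Suc e)"
    unfolding weight_vector_iff_support
  proof (intro conjI allI impI)
    show "0 < t1" "0 < t2" using pos t by auto
    fix i j
    show "t1 * i + t2 * j = t1 + Suc e - 1" if "coeff2 P i j \<noteq> 0"
    proof -
      have "g * (t1 * i + t2 * j) = g * (t1 + e)"
        using P [OF that] pos e by (simp add: t algebra_simps)
      then show ?thesis using \<open>0 < g\<close> by simp
    qed
    show "t1 * i + t2 * j = t2 + Suc e - 1" if "coeff2 Q i j \<noteq> 0"
    proof -
      have "g * (t1 * i + t2 * j) = g * (t2 + e)"
        using Q [OF that] pos e by (simp add: t algebra_simps)
      then show ?thesis using \<open>0 < g\<close> by simp
    qed
  qed simp
  then have "s1 \<le> t1"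
    using min by (auto simp: minimal_weight_vector_def)
  then have "g \<le> 1"
    using t pos by (metis One_nat_def mult_le_cancel2 mult_is_0 nat_mult_1 not_gr_zero)
  then show ?thesis
    using \<open>0 < g\<close> unfolding coprime_iff_gcd_eq_1 g_def by linarith
qed

text \<open>
  As the weights are coprime, the equation determines \<open>e\<close> modulo \<open>s2\<close> and \<open>f\<close> modulo \<open>s1\<close>; what remains after removing the residues is that the sum of the two quotients is constant.
\<close>

lemma lattice_points_on_weight_line:
  fixes s1 s2 e f e0 f0 :: nat
  assumes cop: "coprime s1 s2" and pos: "0 < s1" "0 < s2"
    and eq: "s1 * e + s2 * f = s1 * e0 + s2 * f0"
  obtains k where "k \<le> e0 div s2 + f0 div s1" "e = e0 mod s2 + s2 * k"
    "f = f0 mod s1 + s1 * (e0 div s2 + f0 div s1 - k)"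
proof -
  have "[s1 * e + s2 * f = s1 * e0 + s2 * f0] (mod s2)" "[s1 * e + s2 * f = s1 * e0 + s2 * f0] (mod s1)"
    by (simp_all add: eq)
  then have "[s1 * e = s1 * e0] (mod s2)" "[s2 * f = s2 * f0] (mod s1)"
    by (auto simp: cong_def)
  then have cong: "e mod s2 = e0 mod s2" "f mod s1 = f0 mod s1"
    using cop by (auto simp: cong_mult_lcancel_nat coprime_commute cong_def [symmetric])
  have cancel: "s1 * s2 * (A + B) = s1 * s2 * (A' + B')"
    if "s1 * (R + s2 * A) + s2 * (T + s1 * B) = s1 * (R + s2 * A') + s2 * (T + s1 * B')"
    for R T A B A' B' :: nat
    using that by (simp add: algebra_simps)
  have "s1 * (e0 mod s2 + s2 * (e div s2)) + s2 * (f0 mod s1 + s1 * (f div s1)) = s1 * e + s2 * f"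
    by (simp flip: cong)
  also have "\<dots> = s1 * (e0 mod s2 + s2 * (e0 div s2)) + s2 * (f0 mod s1 + s1 * (f0 div s1))"
    by (simp add: eq)
  finally have "s1 * s2 * (e div s2 + f div s1) = s1 * s2 * (e0 div s2 + f0 div s1)"
    by (rule cancel)
  then have sum: "e div s2 + f div s1 = e0 div s2 + f0 div s1"
    using pos by simp
  show ?thesis
  proof (rule that [of "e div s2"])
    show "e div s2 \<le> e0 div s2 + f0 div s1" using sum by simp
    show "e = e0 mod s2 + s2 * (e div s2)" by (simp flip: cong)
    have "e0 div s2 + f0 div s1 - e div s2 = f div s1" using sum by simp
    then show "f = f0 mod s1 + s1 * (e0 div s2 + f0 div s1 - e div s2)" by (simp flip: cong)
  qed
qed

lemma eval2_on_weight_line: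
  assumes supp: "\<And>i j. coeff2 p i j \<noteq> 0 \<Longrightarrow> \<exists>k\<le>N. i = r + s2 * k \<and> j = t + s1 * (N - k)"
    and pos: "0 < s2"
  shows "eval2 p x y = x ^ r * y ^ t *
    (\<Sum>k\<le>N. coeff2 p (r + s2 * k) (t + s1 * (N - k)) * (x ^ s2) ^ k * (y ^ s1) ^ (N - k))"
proof -
  let ?g = "\<lambda>k. (r + s2 * k, t + s1 * (N - k))"
  have inj: "inj_on ?g {..N}"
    using pos by (auto simp: inj_on_def)
  have "eval2 p x y = (\<Sum>(i, j)\<in>?g ` {..N}. coeff2 p i j * x ^ i * y ^ j)"
  proof (rule eval2_eq_sum)
    show "(i, j) \<in> ?g ` {..N}" if "coeff2 p i j \<noteq> 0" for i j
      using supp [OF that] by auto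
  qed simp
  also have "\<dots> = (\<Sum>k\<le>N. x ^ r * y ^ t *
      (coeff2 p (r + s2 * k) (t + s1 * (N - k)) * (x ^ s2) ^ k * (y ^ s1) ^ (N - k)))"
    by (subst sum.reindex [OF inj]) (simp add: power_add mult_ac flip: power_mult)
  finally show ?thesis by (simp add: sum_distrib_left)
qed

text \<open>
  Multiplication by \<open>x^(s2-1)\<close> shifts the line \<open>s1*i + s2*j = s1 + d - 1\<close> of \<open>P\<close>, and
  multiplication by \<open>y^(s1-1)\<close> the line \<open>s1*i + s2*j = s2 + d - 1\<close> of \<open>Q\<close>, onto
  \<open>s1*e + s2*f = s1*s2 + d - 1\<close>.  Any monomial of \<open>P\<close> supplies the residues \<open>r, t\<close> and the degree \<open>N\<close>.
\<close>

lemma common_weight_line: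
  assumes wv: "weight_vector P Q s1 s2 d" and cop: "coprime s1 s2" and "P \<noteq> 0"
  obtains r t N where "r < s2" "t < s1"
    "\<And>i j. coeff2 P i j \<noteq> 0 \<Longrightarrow> \<exists>k\<le>N. i + (s2 - 1) = r + s2 * k \<and> j = t + s1 * (N - k)"
    "\<And>i j. coeff2 Q i j \<noteq> 0 \<Longrightarrow> \<exists>k\<le>N. i = r + s2 * k \<and> j + (s1 - 1) = t + s1 * (N - k)"
proof -
  have pos: "0 < s1" "0 < s2" "0 < d"
    and P: "\<And>i j. coeff2 P i j \<noteq> 0 \<Longrightarrow> s1 * i + s2 * j = s1 + d - 1"
    and Q: "\<And>i j. coeff2 Q i j \<noteq> 0 \<Longrightarrow> s1 * i + s2 * j = s2 + d - 1"
    using wv by (auto simp: weight_vector_iff_support)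
  obtain m n where mn: "s2 = Suc m" "s1 = Suc n"
    using pos by (metis not0_implies_Suc not_less0)
  have lineP: "s1 * (i + (s2 - 1)) + s2 * j = s1 * s2 + (d - 1)" if "coeff2 P i j \<noteq> 0" for i j
    using P [OF that] pos by (simp add: mn algebra_simps)
  have lineQ: "s1 * i + s2 * (j + (s1 - 1)) = s1 * s2 + (d - 1)" if "coeff2 Q i j \<noteq> 0" for i j
    using Q [OF that] pos by (simp add: mn algebra_simps)
  obtain i0 j0 where ij0: "coeff2 P i0 j0 \<noteq> 0"
    using \<open>P \<noteq> 0\<close> by (rule nonzero_obtain_coeff2)
  let ?e = "i0 + (s2 - 1)"
  show ?thesis
  proof (rule that [of "?e mod s2" "j0 mod s1" "?e div s2 + j0 div s1"])
    show "?e mod s2 < s2" "j0 mod s1 < s1" using pos by simp_all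
  next
    fix i j assume "coeff2 P i j \<noteq> 0"
    then have "s1 * (i + (s2 - 1)) + s2 * j = s1 * ?e + s2 * j0"
      using lineP ij0 by metis
    then show "\<exists>k\<le>?e div s2 + j0 div s1. i + (s2 - 1) = ?e mod s2 + s2 * k \<and>
        j = j0 mod s1 + s1 * (?e div s2 + j0 div s1 - k)"
      using lattice_points_on_weight_line [OF cop pos(1,2)] by metis
  next
    fix i j assume "coeff2 Q i j \<noteq> 0"
    then have "s1 * i + s2 * (j + (s1 - 1)) = s1 * ?e + s2 * j0"
      using lineP lineQ ij0 by metis
    then show "\<exists>k\<le>?e div s2 + j0 div s1. i = ?e mod s2 + s2 * k \<and>
        j + (s1 - 1) = j0 mod s1 + s1 * (?e div s2 + j0 div s1 - k)"
      using lattice_points_on_weight_line [OF cop pos(1,2)] by metis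
  qed
qed

section \<open>The change of variables and the time factor\<close>

text \<open>
  With \<open>r/s\<close> in lowest terms \<open>p/q\<close> and \<open>s = g*q\<close>, \<open>r = g*p\<close>, the root of order \<open>q\<close> of \<open>x^s\<close> is
  \<open>x^g\<close>.  For \<open>x < 0\<close> this needs \<open>q\<close> odd, which the divisor \<open>q\<close> of \<open>s\<close> inherits from \<open>s\<close>.
\<close>

lemma rat_power_of_fraction:
  assumes "0 < s" and "0 \<le> x \<or> odd s"
  shows "rat_power (x ^ s) (of_nat r / of_nat s) = x ^ r"
    and "rat_power_defined (x ^ s) (of_nat r / of_nat s)"
proof -
  obtain p q where pq: "quotient_of (of_nat r / of_nat s) = (p, q)"
    by fastforce
  have q: "0 < q" and cop: "coprime p q" and frac: "(of_nat r / of_nat s :: rat) = of_int p / of_int q"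
    using pq by (auto dest: quotient_of_denom_pos quotient_of_coprime quotient_of_div)
  have "(of_int (int r * q) :: rat) = of_int (p * int s)"
    using frac q \<open>0 < s\<close> by (simp add: field_simps)
  then have cross: "int r * q = p * int s"
    by (simp only: of_int_eq_iff)
  then have "q dvd int s"
    using cop by (metis coprime_commute coprime_dvd_mult_right_iff dvd_triv_right)
  then obtain h where h: "int s = q * h" ..
  then have "0 < h"
    using \<open>0 < s\<close> q by (metis of_nat_0_less_iff zero_less_mult_pos)
  have r: "int r = p * h"
    using cross q by (simp add: h)
  then have "0 \<le> p"
    using \<open>0 < h\<close> by (metis of_nat_0_le_iff zero_le_mult_iff not_less)
  define m n g where "m = nat p" and "n = nat q" and "g = nat h"
  have nat: "p = int m" "q = int n" "h = int g"
    using q \<open>0 < h\<close> \<open>0 \<le> p\<close> by (auto simp: m_def n_def g_def)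
  have sr: "s = g * n" "r = g * m"
    using h r unfolding nat by (simp_all flip: of_nat_mult)
  have "root n ((x ^ g) ^ n) = x ^ g"
  proof (cases "odd n")
    case True
    then show ?thesis by (rule odd_real_root_power_cancel)
  next
    case False
    then show ?thesis
      using assms(2) q sr nat by (auto intro!: real_root_power_cancel)
  qed
  then show "rat_power (x ^ s) (of_nat r / of_nat s) = x ^ r"
    unfolding rat_power_def pq by (simp add: nat sr power_mult)
  show "rat_power_defined (x ^ s) (of_nat r / of_nat s)"
    using assms(2) unfolding rat_power_defined_def pq by (auto simp: nat sr)
qed

lemma power_change_inj_on:
  assumes "restriction_domain s1 s2 U" "0 < s1" "0 < s2"
  shows "inj_on (power_change s1 s2) U"
proof -
  have inj: "x = x'" if "x ^ s = x' ^ s" "0 < s" "odd s \<or> 0 < x \<and> 0 < x'" for x x' :: real and s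
    using that by (metis odd_real_root_power_cancel order_less_imp_le power_eq_imp_eq_base)
  show ?thesis
    using assms by (auto simp: inj_on_def power_change_def restriction_domain_def intro: inj)
qed

text \<open>
  The exponents of the time factor are \<open>r/s2\<close> and \<open>t/s1\<close>: on the chosen half-plane, each variable is
  positive or its exponent in the change of variables is odd, so that these powers of \<open>x^s2\<close> and
  \<open>y^s1\<close> are \<open>x^r\<close> and \<open>y^t\<close>.
\<close>

lemma transformable_by_power_change:
  assumes dom: "restriction_domain s1 s2 U" and pos: "0 < s1" "0 < s2"
    and P: "\<And>x y. real s2 * x ^ (s2 - 1) * eval2 P x y = x ^ r * y ^ t * fst (G (x ^ s2, y ^ s1))"
    and Q: "\<And>x y. real s1 * y ^ (s1 - 1) * eval2 Q x y = x ^ r * y ^ t * snd (G (x ^ s2, y ^ s1))"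
  shows "transformable s1 s2 U (planar_field P Q) G"
  unfolding transformable_def
proof (intro conjI exI)
  let ?a = "of_nat r / of_nat s2" and ?b = "of_nat t / of_nat s1"
  show "inj_on (power_change s1 s2) U"
    using dom pos by (rule power_change_inj_on)
  show "0 \<le> (?a :: rat)" "0 \<le> (?b :: rat)" by simp_all
  have U: "(0 \<le> x \<or> odd s2) \<and> (0 \<le> y \<or> odd s1)" if "(x, y) \<in> U" for x y
    using dom that unfolding restriction_domain_def by auto
  show "\<forall>(u, v)\<in>power_change s1 s2 ` U. rat_power_defined u ?a \<and> rat_power_defined v ?b"
    using U pos by (auto simp: power_change_def intro!: rat_power_of_fraction(2))
  show "transforms_on {p \<in> U. time_factor ?a ?b (power_change s1 s2 p) \<noteq> 0}
     (power_change s1 s2) (time_factor ?a ?b) (planar_field P Q) G"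
    unfolding transforms_on_def
  proof (rule ballI)
    fix p assume p: "p \<in> {p \<in> U. time_factor ?a ?b (power_change s1 s2 p) \<noteq> 0}"
    obtain x y where p_eq: "p = (x, y)" by fastforce
    have xy: "(x, y) \<in> U" and nz: "time_factor ?a ?b (power_change s1 s2 (x, y)) \<noteq> 0"
      using p by (auto simp: p_eq)
    have rho: "time_factor ?a ?b (power_change s1 s2 (x, y)) = x ^ r * y ^ t"
      using U [OF xy] pos by (simp add: time_factor_def power_change_def rat_power_of_fraction(1))
    let ?D = "\<lambda>h. (real s2 * x ^ (s2 - 1) * fst h, real s1 * y ^ (s1 - 1) * snd h)"
    have "((\<lambda>p. (fst p ^ s2, snd p ^ s1)) has_derivative ?D) (at (x, y))"
      by (auto intro!: derivative_eq_intros simp: fun_eq_iff mult_ac)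
    then have "(power_change s1 s2 has_derivative ?D) (at (x, y))"
      by (simp add: power_change_def split_def)
    moreover have "?D (planar_field P Q (x, y)) =
        time_factor ?a ?b (power_change s1 s2 (x, y)) *\<^sub>R G (power_change s1 s2 (x, y))"
      unfolding rho using P [of x y] Q [of y x]
      by (simp add: planar_field_def power_change_def prod_eq_iff)
    ultimately show "time_factor ?a ?b (power_change s1 s2 p) \<noteq> 0 \<and>
      (\<exists>D. (power_change s1 s2 has_derivative D) (at p) \<and> D (planar_field P Q p) =
        time_factor ?a ?b (power_change s1 s2 p) *\<^sub>R G (power_change s1 s2 p))"
      using nz unfolding p_eq by blast
  qed
qed

section \<open>Absence of common factors, and the degree\<close>

text \<open>
  Otherwise \<open>x\<close>, which is the constant \<open>[:[:0, 1:]:]\<close> of \<open>\<real>[x][y]\<close>, would divide both polynomials.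
\<close>

lemma coprime_imp_pure_y_monomial:
  assumes "coprime P Q"
  obtains j where "coeff2 P 0 j \<noteq> 0" | j where "coeff2 Q 0 j \<noteq> 0"
proof -
  have dvd: "[:[:0, 1:]:] dvd p" if "\<And>j. coeff2 p 0 j = 0" for p :: "real poly poly"
    using that by (auto simp: const_poly_dvd_iff dvd_iff_poly_eq_0 [of 0, simplified] poly_0_coeff_0)
  have "\<not> ([:[:0, 1:]:] :: real poly poly) dvd 1"
    by (simp add: is_unit_const_poly_iff is_unit_pCons_iff)
  with assms have "\<not> ([:[:0, 1:]:] dvd P \<and> [:[:0, 1:]:] dvd Q)"
    using coprime_common_divisor by blast
  then show ?thesis using dvd that by blast
qed

text \<open>
  Otherwise \<open>y\<close>, which is \<open>[:0, 1:]\<close> in \<open>\<real>[x][y]\<close>, would divide both polynomials.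
\<close>

lemma coprime_imp_pure_x_monomial:
  assumes "coprime P Q"
  obtains i where "coeff2 P i 0 \<noteq> 0" | i where "coeff2 Q i 0 \<noteq> 0"
proof -
  have dvd: "[:0, 1:] dvd p" if "\<And>i. coeff2 p i 0 = 0" for p :: "real poly poly"
  proof -
    have "coeff p 0 = 0" using that by (intro poly_eqI) simp
    then show ?thesis by (simp add: dvd_iff_poly_eq_0 [of 0, simplified] poly_0_coeff_0)
  qed
  have "\<not> ([:0, 1:] :: real poly poly) dvd 1"
    using dvd_iff_poly_eq_0 [of "0 :: real poly" 1] by simp
  with assms have "\<not> ([:0, 1:] dvd P \<and> [:0, 1:] dvd Q)"
    using coprime_common_divisor by blast
  then show ?thesis using dvd that by blast
qed

lemma total_degree_ge:
  assumes "coeff2 p i j \<noteq> 0"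
  shows "i + j \<le> total_degree p"
proof -
  have "{i + j | i j. coeff2 p i j \<noteq> 0} = (\<lambda>(i, j). i + j) ` {(i, j). coeff2 p i j \<noteq> 0}"
    by auto
  then show ?thesis
    unfolding total_degree_def using assms finite_support [of p] by (intro Max_ge) auto
qed

lemma total_degree_attained:
  assumes "0 < total_degree p"
  obtains i j where "coeff2 p i j \<noteq> 0" "i + j = total_degree p"
proof -
  have "{i + j | i j. coeff2 p i j \<noteq> 0} = (\<lambda>(i, j). i + j) ` {(i, j). coeff2 p i j \<noteq> 0}"
    by auto
  then have "finite (insert 0 {i + j | i j. coeff2 p i j \<noteq> 0})"
    using finite_support [of p] by simp
  then have "total_degree p \<in> insert 0 {i + j | i j. coeff2 p i j \<noteq> 0}"
    unfolding total_degree_def by (intro Max_in) auto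
  then show ?thesis using assms that by auto
qed

section \<open>Classification of the reduced fields in degree five\<close>

definition form_field :: "nat \<Rightarrow> (nat \<Rightarrow> real) \<Rightarrow> (nat \<Rightarrow> real) \<Rightarrow> real \<times> real \<Rightarrow> real \<times> real" where
  "form_field N a b = (\<lambda>(u, v). (\<Sum>k\<le>N. a k * u ^ k * v ^ (N - k), \<Sum>k\<le>N. b k * u ^ k * v ^ (N - k)))"

lemma is_H0_form_field:
  assumes "a 0 * b 0 \<noteq> 0"
  shows "is_H0 (form_field 0 a b)"
proof -
  have "form_field 0 a b = (\<lambda>(x, y). (a 0, b 0))"
    by (simp add: form_field_def)
  with assms show ?thesis unfolding is_H0_def by blast
qed

lemma is_H1_form_field:
  assumes "a 0 * b 1 \<noteq> 0 \<or> b 1 = 0 \<and> a 0 * a 1 * b 0 \<noteq> 0 \<or> a 0 = 0 \<and> a 1 * b 0 * b 1 \<noteq> 0"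
  shows "is_H1 (form_field 1 a b)"
proof -
  have "form_field 1 a b = (\<lambda>(x, y). (a 0 * y + a 1 * x, b 0 * y + b 1 * x))"
    by (simp add: form_field_def)
  with assms show ?thesis unfolding is_H1_def by blast
qed

lemma is_H2_form_field:
  assumes "a 0 * b 2 \<noteq> 0 \<or> a 0 = 0 \<and> b 2 = 0 \<and> a 2 * b 0 \<noteq> 0"
  shows "is_H2 (form_field 2 a b)"
proof -
  have "form_field 2 a b = (\<lambda>(x, y). (a 0 * y\<^sup>2 + a 1 * x * y + a 2 * x\<^sup>2,
                                      b 0 * y\<^sup>2 + b 1 * x * y + b 2 * x\<^sup>2))"
    by (simp add: form_field_def numeral_2_eq_2)
  with assms show ?thesis unfolding is_H2_def by blast
qed

lemma is_H3_form_field: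
  assumes "a 0 = 0" "b 3 = 0" "a 3 * b 0 \<noteq> 0"
  shows "is_H3 (form_field 3 a b)"
proof -
  have "form_field 3 a b = (\<lambda>(x, y). (x * (a 1 * y\<^sup>2 + a 2 * x * y + a 3 * x\<^sup>2),
                                      y * (b 0 * y\<^sup>2 + b 1 * x * y + b 2 * x\<^sup>2)))"
    using assms(1,2) by (simp add: form_field_def fun_eq_iff numeral_2_eq_2 numeral_3_eq_3 algebra_simps)
  with assms(3) show ?thesis unfolding is_H3_def by blast
qed

text \<open>
  This is the part of the argument that knows only exponents.  The coefficient \<open>a k\<close> stands for the
  monomial of \<open>P\<close> whose exponents are \<open>r + s2*k - (s2-1)\<close> and \<open>t + s1*(N-k)\<close>, and \<open>b k\<close> for the
  monomial of \<open>Q\<close> with exponents \<open>r + s2*k\<close> and \<open>t + s1*(N-k) - (s1-1)\<close>.  Hence the conditions \<open>A\<close>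
  and \<open>B\<close>: the exponents are nonnegative and their sum is at most 5.  The condition \<open>quintic\<close> says
  that the sum is 5 for some monomial, and \<open>no_x\<close>, \<open>no_y\<close> that \<open>x\<close>, \<open>y\<close> are not common factors.
\<close>

lemma quintic_form_field_cases:
  fixes a b :: "nat \<Rightarrow> real"
  assumes weights: "0 < s2" "s2 < s1" "r < s2" "t < s1"
    and A: "\<And>k. k \<le> N \<Longrightarrow> a k \<noteq> 0 \<Longrightarrow>
      s2 \<le> Suc (r + s2 * k) \<and> Suc (r + s2 * k + (t + s1 * (N - k))) \<le> 5 + s2"
    and B: "\<And>k. k \<le> N \<Longrightarrow> b k \<noteq> 0 \<Longrightarrow>
      s1 \<le> Suc (t + s1 * (N - k)) \<and> Suc (r + s2 * k + (t + s1 * (N - k))) \<le> 5 + s1"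
    and nonzero: "\<exists>k\<le>N. a k \<noteq> 0" "\<exists>k\<le>N. b k \<noteq> 0"
    and quintic: "\<exists>k\<le>N. a k \<noteq> 0 \<and> Suc (r + s2 * k + (t + s1 * (N - k))) = 5 + s2 \<or>
      b k \<noteq> 0 \<and> Suc (r + s2 * k + (t + s1 * (N - k))) = 5 + s1"
    and no_x: "r = 0 \<and> b 0 \<noteq> 0 \<or> Suc r = s2 \<and> a 0 \<noteq> 0"
    and no_y: "t = 0 \<and> a N \<noteq> 0 \<or> Suc t = s1 \<and> b N \<noteq> 0"
  shows "is_H3 (form_field N a b) \<or> is_H2 (form_field N a b) \<or>
    is_H1 (form_field N a b) \<or> is_H0 (form_field N a b)"
proof -
  have A0: "Suc r = s2" "t + s1 * N \<le> 5" if "a 0 \<noteq> 0"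
    using A [of 0] that weights by auto
  have B0: "r + t + s1 * N \<le> 4 + s1" if "b 0 \<noteq> 0"
    using B [of 0] that by auto
  have bN: "Suc t = s1" if "b N \<noteq> 0"
    using B [of N] that weights by auto
  have "2 \<le> s1" using weights by linarith
  have "N < 4"
  proof (rule ccontr)
    assume "\<not> N < 4"
    then obtain n where "N = n + 4"
      by (metis add.commute le_Suc_ex not_less)
    then have "s1 * 4 \<le> s1 * N" unfolding mult_le_cancel1 by simp
    moreover have "s1 * N \<le> 5 \<or> s1 * N \<le> 4 + s1"
      using no_x A0 B0 by linarith
    ultimately show False
      using \<open>2 \<le> s1\<close> by linarith
  qed
  then consider "N = 0" | "N = 1" | "N = 2" | "N = 3" by linarith
  then show ?thesis
  proof cases
    case 1
    then have "a 0 * b 0 \<noteq> 0" using nonzero by simp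
    then show ?thesis using is_H0_form_field [of a b] 1 by blast
  next
    case 2
    have ab: "a 0 \<noteq> 0 \<or> a 1 \<noteq> 0" "b 0 \<noteq> 0 \<or> b 1 \<noteq> 0"
      using nonzero unfolding 2 by (metis One_nat_def le_Suc_eq le_zero_eq)+
    \<comment> \<open>otherwise \<open>P\<close> and \<open>Q\<close> are multiples of \<open>x\<close> and \<open>y\<close>, and the degree is 1\<close>
    have "a 0 \<noteq> 0" if "r = 0" "t = 0" "b 1 = 0"
    proof
      assume "a 0 = 0"
      obtain k where "k \<le> 1" and k: "a k \<noteq> 0 \<and> Suc (s2 * k + s1 * (1 - k)) = 5 + s2 \<or>
          b k \<noteq> 0 \<and> Suc (s2 * k + s1 * (1 - k)) = 5 + s1"
        using quintic unfolding 2 \<open>r = 0\<close> \<open>t = 0\<close> by auto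
      from \<open>k \<le> 1\<close> have "k = 0 \<or> k = 1" by linarith
      then show False
        using k \<open>a 0 = 0\<close> \<open>b 1 = 0\<close> by (elim disjE) simp_all
    qed
    then have "a 0 * b 1 \<noteq> 0 \<or> b 1 = 0 \<and> a 0 * a 1 * b 0 \<noteq> 0 \<or> a 0 = 0 \<and> a 1 * b 0 * b 1 \<noteq> 0"
      using ab no_x no_y unfolding 2 mult_eq_0_iff by argo
    then show ?thesis using is_H1_form_field [of a b] 2 by blast
  next
    case 3
    have "a 0 * b 2 \<noteq> 0 \<or> a 0 = 0 \<and> b 2 = 0 \<and> a 2 * b 0 \<noteq> 0"
    \<comment> \<open>if \<open>s1 \<ge> 3\<close>, the bound 5 leaves only the alternative \<open>a 0 = b 2 = 0\<close>\<close>
    proof (cases "s1 = 2")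
      case s1: True
      then have "s2 = 1" "r = 0" using weights by linarith+
      obtain k where "k \<le> 2"
        and k: "a k \<noteq> 0 \<and> Suc (k + (t + 2 * (2 - k))) = 6 \<or> b k \<noteq> 0 \<and> Suc (k + (t + 2 * (2 - k))) = 7"
        using quintic unfolding 3 s1 \<open>s2 = 1\<close> \<open>r = 0\<close> by auto
      \<comment> \<open>with weights 2 and 1 the only monomial of degree 5 is \<open>y^5\<close> in \<open>P\<close>\<close>
      from \<open>k \<le> 2\<close> have "k = 0 \<or> k = 1 \<or> k = 2" by linarith
      then have "t = 1 \<and> a 0 \<noteq> 0"
        using k weights(4) unfolding s1 by (elim disjE) simp_all
      then show ?thesis
        using no_y 3 by simp
    next
      case False
      with \<open>2 \<le> s1\<close> have "3 \<le> s1" by linarith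
      have "a 0 = 0"
        using A0(2) \<open>3 \<le> s1\<close> unfolding 3 by linarith
      then have "b 0 \<noteq> 0" using no_x by blast
      then have "Suc t \<noteq> s1"
        using B0 \<open>3 \<le> s1\<close> unfolding 3 by linarith
      then have "b N = 0" "a N \<noteq> 0" using no_y bN by blast+
      then show ?thesis
        using \<open>a 0 = 0\<close> \<open>b 0 \<noteq> 0\<close> unfolding 3 by simp
    qed
    then show ?thesis using is_H2_form_field [of a b] 3 by blast
  next
    case 4
    have "a 0 = 0"
      using A0(2) \<open>2 \<le> s1\<close> unfolding 4 by linarith
    then have "b 0 \<noteq> 0" using no_x by blast
    then have "t = 0"
      using B0 \<open>2 \<le> s1\<close> unfolding 4 by linarith
    then have "b N = 0" "a N \<noteq> 0" using no_y bN \<open>2 \<le> s1\<close> by fastforce+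
    then have "is_H3 (form_field 3 a b)"
      using is_H3_form_field [of a b] \<open>a 0 = 0\<close> \<open>b 0 \<noteq> 0\<close> unfolding 4 by simp
    then show ?thesis using 4 by blast
  qed
qed

theorem theorem6:
  fixes P Q :: "real poly poly" and s1 s2 d :: nat and U :: "(real \<times> real) set"
  assumes "admissible_system P Q"
    and "system_degree P Q = 5"
    and "quasi_homogeneous P Q"
    and "\<not> homogeneous P Q"
    and "minimal_weight_vector P Q s1 s2 d"
    and "s1 > s2"
    and "restriction_domain s1 s2 U"
  shows "\<exists>G. (is_H3 G \<or> is_H2 G \<or> is_H1 G \<or> is_H0 G) \<and>
             transformable s1 s2 U (planar_field P Q) G"
proof -
  have P0: "P \<noteq> 0" and Q0: "Q \<noteq> 0" and coprime_PQ: "coprime P Q"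
    using assms(1) by (auto simp: admissible_system_def)
  have wv: "weight_vector P Q s1 s2 d"
    using assms(5) by (simp add: minimal_weight_vector_def)
  then have pos: "0 < s1" "0 < s2" by (auto simp: weight_vector_def)
  have cop: "coprime s1 s2"
    using assms(5) P0 by (rule minimal_weights_coprime)
  obtain r t N where rt: "r < s2" "t < s1"
    and P: "\<And>i j. coeff2 P i j \<noteq> 0 \<Longrightarrow> \<exists>k\<le>N. i + (s2 - 1) = r + s2 * k \<and> j = t + s1 * (N - k)"
    and Q: "\<And>i j. coeff2 Q i j \<noteq> 0 \<Longrightarrow> \<exists>k\<le>N. i = r + s2 * k \<and> j + (s1 - 1) = t + s1 * (N - k)"
    using common_weight_line [OF wv cop P0] by metis
  \<comment> \<open>the components of the velocity in the new variables, up to the factors \<open>s2\<close> and \<open>s1\<close>\<close>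
  define X where "X = smult (monom 1 (s2 - 1)) P"
  define Y where "Y = monom 1 (s1 - 1) * Q"
  have coeff_X: "coeff2 X e f = (if e < s2 - 1 then 0 else coeff2 P (e - (s2 - 1)) f)" for e f
    by (simp add: X_def coeff_monom_mult)
  have coeff_Y: "coeff2 Y e f = (if f < s1 - 1 then 0 else coeff2 Q e (f - (s1 - 1)))" for e f
    by (simp add: Y_def coeff_monom_mult)
  define a where "a k = real s2 * coeff2 X (r + s2 * k) (t + s1 * (N - k))" for k
  define b where "b k = real s1 * coeff2 Y (r + s2 * k) (t + s1 * (N - k))" for k
  have suppX: "\<exists>k\<le>N. e = r + s2 * k \<and> f = t + s1 * (N - k)" if "coeff2 X e f \<noteq> 0" for e f
    using that P [of f "e - (s2 - 1)"] by (auto simp: coeff_X split: if_splits)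
  have suppY: "\<exists>k\<le>N. e = r + s2 * k \<and> f = t + s1 * (N - k)" if "coeff2 Y e f \<noteq> 0" for e f
    using that Q [of "f - (s1 - 1)" e] by (auto simp: coeff_Y split: if_splits)
  have reduced: "transformable s1 s2 U (planar_field P Q) (form_field N a b)"
  proof (rule transformable_by_power_change [OF assms(7) pos])
    fix x y
    have "real s2 * x ^ (s2 - 1) * eval2 P x y = real s2 * eval2 X x y"
      by (simp add: X_def eval2_def poly_monom)
    also have "\<dots> = x ^ r * y ^ t * fst (form_field N a b (x ^ s2, y ^ s1))"
      by (subst eval2_on_weight_line [OF suppX pos(2)])
        (simp_all add: form_field_def a_def sum_distrib_left mult_ac)
    finally show "real s2 * x ^ (s2 - 1) * eval2 P x y =
      x ^ r * y ^ t * fst (form_field N a b (x ^ s2, y ^ s1))" .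
    have "real s1 * y ^ (s1 - 1) * eval2 Q x y = real s1 * eval2 Y x y"
      by (simp add: Y_def eval2_def poly_monom poly_const_pow)
    also have "\<dots> = x ^ r * y ^ t * snd (form_field N a b (x ^ s2, y ^ s1))"
      by (subst eval2_on_weight_line [OF suppY pos(2)])
        (simp_all add: form_field_def b_def sum_distrib_left mult_ac)
    finally show "real s1 * y ^ (s1 - 1) * eval2 Q x y =
      x ^ r * y ^ t * snd (form_field N a b (x ^ s2, y ^ s1))" .
  qed
  have a_mono: "\<exists>k\<le>N. a k \<noteq> 0 \<and> i + (s2 - 1) = r + s2 * k \<and> j = t + s1 * (N - k)"
    if nz: "coeff2 P i j \<noteq> 0" for i j
  proof -
    obtain k where k: "k \<le> N" "i + (s2 - 1) = r + s2 * k" "j = t + s1 * (N - k)"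
      using P [OF nz] by blast
    have "coeff2 X (i + (s2 - 1)) j \<noteq> 0" using that by (simp add: coeff_X)
    then have "a k \<noteq> 0" unfolding a_def using k pos by simp
    with k show ?thesis by blast
  qed
  have b_mono: "\<exists>k\<le>N. b k \<noteq> 0 \<and> i = r + s2 * k \<and> j + (s1 - 1) = t + s1 * (N - k)"
    if nz: "coeff2 Q i j \<noteq> 0" for i j
  proof -
    obtain k where k: "k \<le> N" "i = r + s2 * k" "j + (s1 - 1) = t + s1 * (N - k)"
      using Q [OF nz] by blast
    have "coeff2 Y i (j + (s1 - 1)) \<noteq> 0" using that by (simp add: coeff_Y)
    then have "b k \<noteq> 0" unfolding b_def using k pos by simp
    with k show ?thesis by blast
  qed
  have degrees: "total_degree P \<le> 5" "total_degree Q \<le> 5"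
    "total_degree P = 5 \<or> total_degree Q = 5"
    using assms(2) by (auto simp: system_degree_def max_def split: if_splits)
  have "is_H3 (form_field N a b) \<or> is_H2 (form_field N a b) \<or>
      is_H1 (form_field N a b) \<or> is_H0 (form_field N a b)"
  proof (rule quintic_form_field_cases [OF pos(2) assms(6) rt])
    fix k assume "k \<le> N"
    show "s2 \<le> Suc (r + s2 * k) \<and> Suc (r + s2 * k + (t + s1 * (N - k))) \<le> 5 + s2" if "a k \<noteq> 0"
    proof -
      have "coeff2 X (r + s2 * k) (t + s1 * (N - k)) \<noteq> 0" using that by (simp add: a_def)
      then have le: "s2 - 1 \<le> r + s2 * k"
        and nz: "coeff2 P (r + s2 * k - (s2 - 1)) (t + s1 * (N - k)) \<noteq> 0"
        unfolding coeff_X by (simp_all split: if_splits)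
      show ?thesis
        using total_degree_ge [OF nz] le degrees(1) pos by (intro conjI) linarith+
    qed
    show "s1 \<le> Suc (t + s1 * (N - k)) \<and> Suc (r + s2 * k + (t + s1 * (N - k))) \<le> 5 + s1" if "b k \<noteq> 0"
    proof -
      have "coeff2 Y (r + s2 * k) (t + s1 * (N - k)) \<noteq> 0" using that by (simp add: b_def)
      then have le: "s1 - 1 \<le> t + s1 * (N - k)"
        and nz: "coeff2 Q (r + s2 * k) (t + s1 * (N - k) - (s1 - 1)) \<noteq> 0"
        unfolding coeff_Y by (simp_all split: if_splits)
      show ?thesis
        using total_degree_ge [OF nz] le degrees(2) pos by (intro conjI) linarith+
    qed
  next
    show "\<exists>k\<le>N. a k \<noteq> 0" using nonzero_obtain_coeff2 [OF P0] a_mono by blast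
    show "\<exists>k\<le>N. b k \<noteq> 0" using nonzero_obtain_coeff2 [OF Q0] b_mono by blast
  next
    from degrees(3) show "\<exists>k\<le>N. a k \<noteq> 0 \<and> Suc (r + s2 * k + (t + s1 * (N - k))) = 5 + s2 \<or>
      b k \<noteq> 0 \<and> Suc (r + s2 * k + (t + s1 * (N - k))) = 5 + s1"
    proof
      assume deg: "total_degree P = 5"
      then have "0 < total_degree P" by simp
      then obtain i j where "coeff2 P i j \<noteq> 0" "i + j = total_degree P"
        by (rule total_degree_attained)
      then obtain k where "k \<le> N" "a k \<noteq> 0" "i + (s2 - 1) = r + s2 * k" "j = t + s1 * (N - k)"
        using a_mono by blast
      then show ?thesis
        using \<open>i + j = _\<close> deg pos by (intro exI [of _ k]) linarith
    next
      assume deg: "total_degree Q = 5"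
      then have "0 < total_degree Q" by simp
      then obtain i j where "coeff2 Q i j \<noteq> 0" "i + j = total_degree Q"
        by (rule total_degree_attained)
      then obtain k where "k \<le> N" "b k \<noteq> 0" "i = r + s2 * k" "j + (s1 - 1) = t + s1 * (N - k)"
        using b_mono by blast
      then show ?thesis
        using \<open>i + j = _\<close> deg pos by (intro exI [of _ k]) linarith
    qed
  next
    from coprime_PQ show "r = 0 \<and> b 0 \<noteq> 0 \<or> Suc r = s2 \<and> a 0 \<noteq> 0"
    proof (rule coprime_imp_pure_y_monomial)
      fix j assume "coeff2 P 0 j \<noteq> 0"
      from a_mono [OF this] obtain k where k: "k \<le> N" "a k \<noteq> 0" "s2 - 1 = r + s2 * k"
        by auto
      have "k = 0" using k(3) pos by (cases k) auto
      then show ?thesis using k pos by auto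
    next
      fix j assume "coeff2 Q 0 j \<noteq> 0"
      from b_mono [OF this] show ?thesis using pos by auto
    qed
  next
    from coprime_PQ show "t = 0 \<and> a N \<noteq> 0 \<or> Suc t = s1 \<and> b N \<noteq> 0"
    proof (rule coprime_imp_pure_x_monomial)
      fix i assume "coeff2 P i 0 \<noteq> 0"
      from a_mono [OF this] show ?thesis using pos by auto
    next
      fix i assume "coeff2 Q i 0 \<noteq> 0"
      from b_mono [OF this] obtain k where k: "k \<le> N" "b k \<noteq> 0" "s1 - 1 = t + s1 * (N - k)"
        by auto
      have "N - k = 0" using k(3) pos by (cases "N - k") auto
      then show ?thesis using k pos by auto
    qed
  qed
  with reduced show ?thesis by blast
qed

end
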